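(* For positive integers $w$ and $n$, \begin{align*} |T_n(2w+1)|&=|\mathrm{Mot}_n(w)|,\\ |T_n(2w)|&=|\mathrm{Mot}'_n(w)|,\\ |\mathrm{DP}_n(2w+1)|&=|\mathrm{Mot}^1_n(w)|,\\ |\mathrm{DP}_n(2w)|&=\sum_{p\in\mathrm{Mot}^2_n(w)}(-1)^{k(p)}, \end{align*} where $k(p)$ is the number of horizontal steps of $p$ on the line $x_2=w$.
   Context: $T_n(m)$ is the set of walks of length $n$ from $(0,0)$ to any point in $\mathbb Z^2$ consisting of steps in $\{(1,0),(0,1),(-1,-1)\}$ and contained in $\{(x_1,x_2)\in\mathbb R^2:m\ge x_1\ge x_2\ge0\}$. A Motzkin path of length $n$ is a path from $(0,0)$ to $(n,0)$ consisting of up steps $(1,1)$, down steps $(1,-1)$ and horizontal steps $(1,0)$ that never goes below the $x$-axis; its height is the largest $y$-coordinate of a point in it. $\mathrm{Mot}_n(m)$ is the set of Motzkin paths of length $n$ with height at most $m$. Writing $(x_1,x_2)$ for coordinates in the plane: $\mathrm{Mot}'_n(w)$ is the set of $p\in\mathrm{Mot}_n(w)$ with no horizontal step on the line $x_2=w$; $\mathrm{Mot}^1_n(w)$ is the set of $p\in\mathrm{Mot}_n(w)$ all of whose horizontal steps lie on the line $x_2=0$; $\mathrm{Mot}^2_n(w)$ is the set of $p\in\mathrm{Mot}_n(w)$ all of whose horizontal steps lie on the lines $x_2=0$ and $x_2=w$. A Dyck path is a Motzkin path without horizontal steps; a Dyck prefix is a path (sequence of points starting at $(0,0)$) that can be extended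 to a Dyck path. $\mathrm{DP}_n(w)$ is the set of Dyck prefixes of length $n$ (i.e. with $n$ steps) contained in $\{(x_1,x_2)\in\mathbb R^2:0\le x_2\le w\}$. *)

theory Defs
  imports Complex_Main "HOL-Library.Product_Plus"
begin

text \<open>A walk is its list of lattice points, so a walk with \<open>n\<close> steps has \<open>n + 1\<close> points. All regions
  considered are convex, so a walk (with its line segments) is contained in one of them if and only
  if its points are.\<close>

type_synonym point = "int \<times> int"

definition walk :: "point set \<Rightarrow> point list \<Rightarrow> bool" where
  "walk S p \<longleftrightarrow> p \<noteq> [] \<and> hd p = (0, 0) \<and> (\<forall>i. Suc i < length p \<longrightarrow> p ! Suc i - p ! i \<in> S)"

definition num_steps :: "point list \<Rightarrow> nat" where
  "num_steps p = length p - 1"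

definition T :: "nat \<Rightarrow> nat \<Rightarrow> point list set" where
  "T n m = {p. walk {(1, 0), (0, 1), (-1, -1)} p \<and> num_steps p = n \<and>
               set p \<subseteq> {(x1, x2). int m \<ge> x1 \<and> x1 \<ge> x2 \<and> x2 \<ge> 0}}"

definition motzkin_path :: "nat \<Rightarrow> point list \<Rightarrow> bool" where
  "motzkin_path n p \<longleftrightarrow>
     walk {(1, 1), (1, -1), (1, 0)} p \<and> last p = (int n, 0) \<and> (\<forall>(x1, x2) \<in> set p. x2 \<ge> 0)"

definition height :: "point list \<Rightarrow> int" where
  "height p = Max (snd ` set p)"

definition Mot :: "nat \<Rightarrow> nat \<Rightarrow> point list set" where
  "Mot n m = {p. motzkin_path n p \<and> height p \<le> int m}"

text \<open>A step is represented by the index of its starting point.\<close>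

definition horizontal_steps :: "point list \<Rightarrow> nat set" where
  "horizontal_steps p = {i. Suc i < length p \<and> p ! Suc i - p ! i = (1, 0)}"

definition horizontal_steps_on :: "int \<Rightarrow> point list \<Rightarrow> nat set" where
  "horizontal_steps_on h p = {i \<in> horizontal_steps p. snd (p ! i) = h}"

definition Mot' :: "nat \<Rightarrow> nat \<Rightarrow> point list set" where
  "Mot' n w = {p \<in> Mot n w. horizontal_steps_on (int w) p = {}}"

definition Mot1 :: "nat \<Rightarrow> nat \<Rightarrow> point list set" where
  "Mot1 n w = {p \<in> Mot n w. horizontal_steps p \<subseteq> horizontal_steps_on 0 p}"

definition Mot2 :: "nat \<Rightarrow> nat \<Rightarrow> point list set" where
  "Mot2 n w = {p \<in> Mot n w.
     horizontal_steps p \<subseteq> horizontal_steps_on 0 p \<union> horizontal_steps_on (int w) p}"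

definition dyck_path :: "point list \<Rightarrow> bool" where
  "dyck_path p \<longleftrightarrow> (\<exists>n. motzkin_path n p) \<and> horizontal_steps p = {}"

definition dyck_prefix :: "point list \<Rightarrow> bool" where
  "dyck_prefix p \<longleftrightarrow> p \<noteq> [] \<and> (\<exists>q. dyck_path (p @ q))"

definition DP :: "nat \<Rightarrow> nat \<Rightarrow> point list set" where
  "DP n w = {p. dyck_prefix p \<and> num_steps p = n \<and>
                set p \<subseteq> {(x1, x2). 0 \<le> x2 \<and> x2 \<le> int w}}"

end

theory Submission
  imports Defs
begin

text \<open>
  The left-hand sides count walks with a free end point inside a region bounded by a wall at
  distance \<open>m = 2w\<close> or \<open>m = 2w + 1\<close>; the right-hand sides count Motzkin paths, which must return to
  height \<open>0\<close>, in a strip of about half that width. Let \<open>f\<^sub>n(x)\<close> be the number of walks of length \<open>n\<close>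
  that start in \<open>x\<close>. The idea is to trade \<open>f\<^sub>n\<close> for a function \<open>e\<^sub>n(k)\<close> of a single integer \<open>k\<close> that
  satisfies the recurrence of Motzkin paths,
  \<open>e\<^sub>n\<^sub>+\<^sub>1(k) = e\<^sub>n(k - 1) + l(k) e\<^sub>n(k) + e\<^sub>n(k + 1)\<close>, where \<open>l(k)\<close> is the weight of a horizontal step at
  height \<open>k\<close>, with \<open>e\<^sub>n(0) = f\<^sub>n(0)\<close> and \<open>e\<^sub>0(k) = [k = 0]\<close> for \<open>0 \<le> k \<le> w\<close>, and
  \<open>e\<^sub>n(-1) = 0\<close>.

  The wall at distance \<open>m\<close> shows up as the antisymmetry \<open>e\<^sub>n(m + 1 - k) = - e\<^sub>n(k)\<close>, which lets one fold
  the line at \<open>(m + 1) / 2\<close>. If \<open>m = 2w + 1\<close>, the centre is \<open>w + 1\<close>, so \<open>e\<^sub>n(w + 1) = 0\<close> and the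
  recurrence is that of Motzkin paths of height at most \<open>w\<close>. If \<open>m = 2w\<close>, the centre lies
  between \<open>w\<close> and \<open>w + 1\<close>, so \<open>e\<^sub>n(w + 1) = - e\<^sub>n(w)\<close>: a horizontal step at height \<open>w\<close> gets the extra
  weight \<open>-1\<close>. This is \<open>motzkin_sum_reflection\<close>. It remains to find \<open>e\<^sub>n\<close> in the two cases.

  For Dyck prefixes, \<open>f\<^sub>n\<close> is symmetric under \<open>h \<mapsto> m - h\<close>, and its first difference
  \<open>e\<^sub>n(k) = f\<^sub>n(k) - f\<^sub>n(k - 1)\<close> is antisymmetric. At \<open>k = 0\<close> one has
  \<open>e\<^sub>n\<^sub>+\<^sub>1(0) = f\<^sub>n(1) = e\<^sub>n(0) + e\<^sub>n(1)\<close>, so that \<open>l(k) = [k = 0]\<close>. The extra weight \<open>-1\<close> at height \<open>w\<close> then produces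
  the signs in the fourth identity.

  For walks in the triangle the passage to one variable comes from restricting representations of
  \<open>SL\<^sub>3\<close> to \<open>SL\<^sub>2\<close>. Without the wall at \<open>m\<close>, \<open>f\<^sub>n(x\<^sub>1, x\<^sub>2)\<close> is the number of irreducible components of
  \<open>V(x\<^sub>1, x\<^sub>2)\<close> tensored \<open>n\<close> times with the standard representation \<open>V(1, 0)\<close>. By the interlacing rule
  \<open>V(x\<^sub>1, x\<^sub>2)\<close> restricts to the sum of the \<open>U(i + j)\<close> with \<open>0 \<le> i \<le> x\<^sub>1 - x\<^sub>2\<close> and \<open>0 \<le> j \<le> x\<^sub>2\<close>, where
  \<open>U(k)\<close> is the irreducible representation of dimension \<open>k + 1\<close>. Hence every \<open>V(x\<^sub>1, x\<^sub>2)\<close> contains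
  \<open>U(0)\<close> exactly once, and \<open>V(1, 0)\<close> restricts to \<open>U(0) + U(1)\<close>. Tensoring \<open>U(k)\<close> with \<open>U(0) + U(1)\<close> is a
  Motzkin step from height \<open>k\<close>. So \<open>f\<^sub>n(x\<^sub>1, x\<^sub>2)\<close> is the sum over this rectangle of \<open>e\<^sub>n(i + j)\<close>, where
  \<open>e\<^sub>n(k)\<close> counts Motzkin paths from height \<open>k\<close> to \<open>0\<close>. The wall is now put in by making \<open>e\<^sub>n\<close>
  antisymmetric, since that makes the rectangle sums vanish on the line \<open>x\<^sub>1 = m + 1\<close>. The formula is
  \<open>card_walks_triangle\<close>; its proof rests on the identities \<open>rect_sum_step\<close>
  and \<open>rect_sum_antisym\<close>.
\<close>

section \<open>Walks with a prescribed starting point\<close>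

definition walks :: "point set \<Rightarrow> point set \<Rightarrow> nat \<Rightarrow> point \<Rightarrow> point list set" where
  "walks S R n x = {p. length p = Suc n \<and> hd p = x \<and> successively (\<lambda>y z. z - y \<in> S) p \<and> set p \<subseteq> R}"

lemma walk_iff_successively:
  "walk S p \<longleftrightarrow> p \<noteq> [] \<and> hd p = (0, 0) \<and> successively (\<lambda>y z. z - y \<in> S) p"
  by (simp add: walk_def successively_conv_nth)

lemma walks_0: "walks S R 0 x = (if x \<in> R then {[x]} else {})"
  by (auto simp: walks_def length_Suc_conv)

lemma walks_Suc:
  "walks S R (Suc n) x = (if x \<in> R then \<Union>s\<in>S. (#) x ` walks S R n (x + s) else {})"
proof -
  have "p \<in> walks S R (Suc n) x \<longleftrightarrow> x \<in> R \<and> (\<exists>s\<in>S. \<exists>q\<in>walks S R n (x + s). p = x # q)" for p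
  proof
    assume p: "p \<in> walks S R (Suc n) x"
    then obtain q where q: "p = x # q" "length q = Suc n"
      by (cases p) (auto simp: walks_def)
    with p have "hd q - x \<in> S" "q \<in> walks S R n (x + (hd q - x))" "x \<in> R"
      by (auto simp: walks_def successively_Cons)
    with q show "x \<in> R \<and> (\<exists>s\<in>S. \<exists>q\<in>walks S R n (x + s). p = x # q)" by blast
  next
    assume "x \<in> R \<and> (\<exists>s\<in>S. \<exists>q\<in>walks S R n (x + s). p = x # q)"
    then show "p \<in> walks S R (Suc n) x"
      by (auto simp: walks_def successively_Cons)
  qed
  then show ?thesis by (intro set_eqI) (simp add: image_iff)
qed

lemma finite_walks: "finite S \<Longrightarrow> finite (walks S R n x)"
  by (induction n arbitrary: x) (auto simp: walks_0 walks_Suc)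

lemma sum_walks_Suc:
  fixes \<omega> :: "point list \<Rightarrow> int"
  assumes "finite S"
  shows "sum \<omega> (walks S R (Suc n) x) =
    (if x \<in> R then \<Sum>s\<in>S. \<Sum>p\<in>walks S R n (x + s). \<omega> (x # p) else 0)"
proof (cases "x \<in> R")
  case True
  have "sum \<omega> (walks S R (Suc n) x) = (\<Sum>s\<in>S. sum \<omega> ((#) x ` walks S R n (x + s)))"
    unfolding walks_Suc using True assms
    by (simp, intro sum.UNION_disjoint ballI finite_imageI finite_walks) (auto simp: walks_def)
  also have "\<dots> = (\<Sum>s\<in>S. \<Sum>p\<in>walks S R n (x + s). \<omega> (x # p))"
    by (simp add: sum.reindex)
  finally show ?thesis using True by simp
qed (simp add: walks_Suc)

lemma card_walks_Suc:
  assumes "finite S"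
  shows "int (card (walks S R (Suc n) x)) =
    (if x \<in> R then \<Sum>s\<in>S. int (card (walks S R n (x + s))) else 0)"
  using sum_walks_Suc[OF assms, where \<omega> = "\<lambda>_. 1"] by simp

section \<open>Weighted Motzkin paths\<close>

definition strip :: "nat \<Rightarrow> point set" where
  "strip w = {(x1, x2). 0 \<le> x2 \<and> x2 \<le> int w}"

lemma mem_strip [simp]: "(t, h) \<in> strip w \<longleftrightarrow> 0 \<le> h \<and> h \<le> int w"
  by (simp add: strip_def)

definition level_weight :: "(int \<Rightarrow> int) \<Rightarrow> point list \<Rightarrow> int" where
  "level_weight c p = (\<Prod>i\<in>horizontal_steps p. c (snd (p ! i)))"

lemma finite_horizontal_steps: "finite (horizontal_steps p)"
  by (rule finite_subset[of _ "{..<length p}"]) (auto simp: horizontal_steps_def)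

lemma horizontal_steps_Cons:
  assumes "p \<noteq> []"
  shows "horizontal_steps (x # p) =
    (if hd p - x = (1, 0) then {0} else {}) \<union> Suc ` horizontal_steps p"
proof -
  have "i \<in> horizontal_steps (x # p) \<longleftrightarrow> 
     i \<in> (if hd p - x = (1, 0) then {0} else {}) \<union> Suc ` horizontal_steps p" for i
    using assms by (cases i) (auto simp: horizontal_steps_def hd_conv_nth image_iff)
  then show ?thesis by blast
qed

lemma level_weight_Cons:
  assumes "p \<noteq> []"
  shows "level_weight c (x # p) = (if hd p - x = (1, 0) then c (snd x) else 1) * level_weight c p"
  using assms
  by (auto simp: level_weight_def horizontal_steps_Cons finite_horizontal_steps prod.reindex)

text \<open>The factor \<open>of_bool\<close> imposes the return to height \<open>0\<close>. Keeping that condition in the summand rather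
  than in the index set leaves the recursion of \<open>walks\<close> on the first step intact.\<close>

definition motzkin_sum :: "(int \<Rightarrow> int) \<Rightarrow> nat \<Rightarrow> nat \<Rightarrow> point \<Rightarrow> int" where
  "motzkin_sum c w n x =
    (\<Sum>p\<in>walks {(1, 1), (1, -1), (1, 0)} (strip w) n x. of_bool (snd (last p) = 0) * level_weight c p)"

lemma motzkin_sum_0: "motzkin_sum c w 0 (t, h) = of_bool (h = 0)"
  by (auto simp: motzkin_sum_def walks_0 level_weight_def horizontal_steps_def)

lemma motzkin_sum_outside: "x \<notin> strip w \<Longrightarrow> motzkin_sum c w n x = 0"
  by (cases n) (auto simp: motzkin_sum_def walks_0 walks_Suc)

lemma motzkin_sum_Suc:
  assumes "0 \<le> h" "h \<le> int w"
  shows "motzkin_sum c w (Suc n) (t, h) =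
    motzkin_sum c w n (t + 1, h + 1) + motzkin_sum c w n (t + 1, h - 1)
    + c h * motzkin_sum c w n (t + 1, h)"
proof -
  let ?S = "{(1, 1), (1, -1), (1, 0)} :: point set"
  let ?W = "walks ?S (strip w) n"
  let ?v = "\<lambda>p. of_bool (snd (last p) = 0) * level_weight c p"
  have "(\<Sum>p\<in>?W ((t, h) + s). ?v ((t, h) # p)) =
      (if s = (1, 0) then c h else 1) * sum ?v (?W ((t, h) + s))" for s
    unfolding sum_distrib_left
    by (rule sum.cong) (auto simp: walks_def level_weight_Cons)
  then show ?thesis
    using assms by (simp add: motzkin_sum_def sum_walks_Suc)
qed

lemma walks_fst_nth:
  assumes "p \<in> walks S R n x" "\<And>s. s \<in> S \<Longrightarrow> fst s = 1" "i \<le> n"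
  shows "fst (p ! i) = fst x + int i"
  using assms(3)
proof (induction i)
  case 0
  then show ?case using assms(1) by (cases p) (auto simp: walks_def)
next
  case (Suc i)
  then have "p ! Suc i - p ! i \<in> S"
    using assms(1) by (simp add: walks_def successively_conv_nth)
  from assms(2)[OF this] Suc show ?case by simp
qed

lemma walks_fst_last:
  assumes "p \<in> walks S R n x" "\<And>s. s \<in> S \<Longrightarrow> fst s = 1"
  shows "fst (last p) = fst x + int n"
  using walks_fst_nth[OF assms, of n] assms(1) last_conv_nth[of p] by (force simp: walks_def)

lemma motzkin_pathI:
  assumes "p \<in> walks {(1, 1), (1, -1), (1, 0)} {(x1, x2). 0 \<le> x2} n (0, 0)" "snd (last p) = 0"
  shows "motzkin_path n p"
  using assms walks_fst_last[OF assms(1)]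
  by (force simp: motzkin_path_def walk_iff_successively walks_def prod_eq_iff)

lemma motzkin_pathD:
  assumes "motzkin_path n p"
  shows "p \<in> walks {(1, 1), (1, -1), (1, 0)} {(x1, x2). 0 \<le> x2} n (0, 0)"
proof -
  let ?W = "walks {(1, 1), (1, -1), (1, 0)} {(x1, x2). 0 \<le> x2}"
  from assms have *: "p \<in> ?W (length p - 1) (0, 0)" "last p = (int n, 0)"
    by (auto simp: motzkin_path_def walk_iff_successively walks_def)
  have "fst (last p) = fst (0 :: int, 0 :: int) + int (length p - 1)"
    by (rule walks_fst_last[OF *(1)]) auto
  with *(2) have "length p - 1 = n" by simp
  with * show ?thesis by simp
qed

lemma Mot_eq:
  "Mot n w = {p \<in> walks {(1, 1), (1, -1), (1, 0)} (strip w) n (0, 0). snd (last p) = 0}"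
proof (intro set_eqI iffI)
  fix p assume p: "p \<in> Mot n w"
  then have m: "motzkin_path n p" and "height p \<le> int w" by (auto simp: Mot_def)
  then have "\<forall>y\<in>set p. snd y \<le> int w"
    using Max_ge[of "snd ` set p"] unfolding height_def by fastforce
  with motzkin_pathD[OF m] m
  show "p \<in> {p \<in> walks {(1, 1), (1, -1), (1, 0)} (strip w) n (0, 0). snd (last p) = 0}"
    by (auto simp: walks_def strip_def motzkin_path_def)
next
  fix p assume p: "p \<in> {p \<in> walks {(1, 1), (1, -1), (1, 0)} (strip w) n (0, 0). snd (last p) = 0}"
  then have "p \<in> walks {(1, 1), (1, -1), (1, 0)} {(x1, x2). 0 \<le> x2} n (0, 0)"
    by (auto simp: walks_def strip_def)
  moreover have "height p \<le> int w"
    unfolding height_def using p by (subst Max_le_iff) (auto simp: walks_def strip_def)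
  ultimately show "p \<in> Mot n w" using p motzkin_pathI by (auto simp: Mot_def)
qed

lemma finite_Mot: "finite (Mot n w)"
  by (simp add: Mot_eq finite_walks)

lemma sum_level_weight_Mot: "(\<Sum>p\<in>Mot n w. level_weight c p) = motzkin_sum c w n (0, 0)"
  unfolding Mot_eq motzkin_sum_def
  by (rule sum.mono_neutral_cong_left) (auto simp: finite_walks)

text \<open>The reflection argument. By induction only the values at \<open>-1\<close> and \<open>w + 1\<close>, just outside the strip, need
  attention, since paths that leave the strip do not contribute to the left-hand side. At \<open>-1\<close> also \<open>e\<close>
  vanishes; at \<open>w + 1\<close> the antisymmetry gives \<open>0\<close> if \<open>m = 2w + 1\<close> and \<open>- e n w\<close> if \<open>m = 2w\<close>, and the
  modified weight of a horizontal step at height \<open>w\<close> accounts for the latter.\<close>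

lemma motzkin_sum_reflection:
  fixes e :: "nat \<Rightarrow> int \<Rightarrow> int" and l :: "int \<Rightarrow> int"
  assumes m: "m = 2 * w \<or> m = 2 * w + 1"
    and init: "\<And>k. 0 \<le> k \<Longrightarrow> k \<le> int w \<Longrightarrow> e 0 k = of_bool (k = 0)"
    and step: "\<And>n k. 0 \<le> k \<Longrightarrow> k \<le> int w \<Longrightarrow> e (Suc n) k = e n (k - 1) + l k * e n k + e n (k + 1)"
    and left: "\<And>n. e n (-1) = 0"
    and antisym: "\<And>n k. e n (int m + 1 - k) = - e n k"
    and k: "0 \<le> k" "k \<le> int w"
  shows "motzkin_sum (\<lambda>h. l h - of_bool (m = 2 * w \<and> h = int w)) w n (t, k) = e n k"
    (is "motzkin_sum ?c w n (t, k) = _")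
  using k
proof (induction n arbitrary: t k)
  case 0
  then show ?case by (simp add: motzkin_sum_0 init)
next
  case (Suc n)
  have below: "motzkin_sum ?c w n (t + 1, k - 1) = e n (k - 1)"
  proof (cases "k = 0")
    case True
    then show ?thesis by (simp add: motzkin_sum_outside left)
  next
    case False
    then show ?thesis using Suc by simp
  qed
  have above: "motzkin_sum ?c w n (t + 1, k + 1) =
      e n (k + 1) + of_bool (m = 2 * w \<and> k = int w) * e n k"
  proof (cases "k = int w")
    case True
    have "e n (k + 1) + of_bool (m = 2 * w) * e n k = 0"
      using m antisym[of n "int w"] antisym[of n "int w + 1"] True by (auto simp: add.commute)
    then show ?thesis using True by (simp add: motzkin_sum_outside)
  next
    case False
    then show ?thesis using Suc by simp
  qed
  show ?case
    using Suc.prems Suc.IH[of k "t + 1"] below above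
    by (simp add: motzkin_sum_Suc step algebra_simps)
qed

section \<open>Walks in the triangle\<close>

text \<open>The number of Motzkin paths of length \<open>n\<close> from height \<open>k\<close> to height \<open>0\<close> that stay within \<open>{0..m + 1}\<close>, minus
  the number of those from \<open>k\<close> to \<open>m + 1\<close>. Subtracting the latter makes the count antisymmetric.\<close>

primrec mirrored_motzkin :: "nat \<Rightarrow> nat \<Rightarrow> int \<Rightarrow> int" where
  "mirrored_motzkin m 0 k = of_bool (k = 0) - of_bool (k = int m + 1)"
| "mirrored_motzkin m (Suc n) k = (if 0 \<le> k \<and> k \<le> int m + 1
     then mirrored_motzkin m n (k - 1) + mirrored_motzkin m n k + mirrored_motzkin m n (k + 1) else 0)"

lemma mirrored_motzkin_antisym: "mirrored_motzkin m n (int m + 1 - k) = - mirrored_motzkin m n k"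
proof (induction n arbitrary: k)
  case (Suc n)
  show ?case using Suc[of "k - 1"] Suc[of k] Suc[of "k + 1"] by (auto simp: algebra_simps)
qed auto

lemma mirrored_motzkin_left: "mirrored_motzkin m n (- 1) = 0"
  by (cases n) auto

text \<open>The double sum that the interlacing rule prescribes, with \<open>P = x\<^sub>1 - x\<^sub>2 + 1\<close> and \<open>Q = x\<^sub>2 + 1\<close>. In these
  coordinates the points just outside the triangle have \<open>P = 0\<close>, \<open>Q = 0\<close> or \<open>P + Q = m + 3\<close>, and the sum
  vanishes on the first two lines because it is empty.\<close>

definition rect_sum :: "(int \<Rightarrow> int) \<Rightarrow> nat \<Rightarrow> nat \<Rightarrow> int" where
  "rect_sum d P Q = (\<Sum>i<P. \<Sum>j<Q. d (int i + int j))"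

text \<open>The three sums on the right belong to the three neighbours of \<open>(x\<^sub>1, x\<^sub>2)\<close>, so this says that rectangle
  sums carry Motzkin steps to steps in the triangle. Shifting the argument of \<open>d\<close> by \<open>1\<close> shifts the
  rectangle by one column, and the border rows and columns cancel once \<open>d (-1) = 0\<close>.\<close>

lemma rect_sum_step:
  assumes "d (-1) = 0"
  shows "rect_sum (\<lambda>k. d (k - 1) + d k + d (k + 1)) (Suc P) (Suc Q) =
    rect_sum d (Suc (Suc P)) (Suc Q) + rect_sum d P (Suc (Suc Q)) + rect_sum d (Suc P) Q"
proof -
  have up: "rect_sum d (Suc (Suc P)) (Suc Q) =
      rect_sum (\<lambda>k. d (k + 1)) (Suc P) (Suc Q) + (\<Sum>j<Suc Q. d (int j))"
    unfolding rect_sum_def by (subst sum.lessThan_Suc_shift) (simp add: algebra_simps)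
  have down: "rect_sum (\<lambda>k. d (k - 1)) (Suc P) (Suc Q) =
      rect_sum d (Suc P) Q + (\<Sum>i<Suc P. d (int i - 1))"
  proof -
    have "(\<Sum>j<Suc Q. d (int i + int j - 1)) = d (int i - 1) + (\<Sum>j<Q. d (int i + int j))" for i
      by (subst sum.lessThan_Suc_shift) simp
    then show ?thesis
      by (simp add: rect_sum_def sum.distrib del: sum.lessThan_Suc)
  qed
  have "rect_sum d P (Suc (Suc Q)) =
      (\<Sum>i<P. d (int i)) + (\<Sum>i<P. \<Sum>j<Suc Q. d (int i + 1 + int j))"
  proof -
    have "(\<Sum>j<Suc (Suc Q). d (int i + int j)) = d (int i) + (\<Sum>j<Suc Q. d (int i + 1 + int j))" for i
      by (subst sum.lessThan_Suc_shift) (simp add: algebra_simps)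
    then show ?thesis
      by (simp add: rect_sum_def sum.distrib del: sum.lessThan_Suc)
  qed
  moreover have "rect_sum d (Suc P) (Suc Q) =
      (\<Sum>j<Suc Q. d (int j)) + (\<Sum>i<P. \<Sum>j<Suc Q. d (int i + 1 + int j))"
    unfolding rect_sum_def by (subst sum.lessThan_Suc_shift) (simp add: algebra_simps)
  moreover have "(\<Sum>i<Suc P. d (int i - 1)) = (\<Sum>i<P. d (int i))"
    using assms by (subst sum.lessThan_Suc_shift) simp
  moreover have "rect_sum (\<lambda>k. d (k - 1) + d k + d (k + 1)) (Suc P) (Suc Q) =
      rect_sum (\<lambda>k. d (k - 1)) (Suc P) (Suc Q) + rect_sum d (Suc P) (Suc Q) +
      rect_sum (\<lambda>k. d (k + 1)) (Suc P) (Suc Q)"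
    by (simp add: rect_sum_def sum.distrib)
  ultimately show ?thesis using up down by linarith
qed

text \<open>Rotating the rectangle by a half-turn replaces \<open>i + j\<close> by \<open>P + Q - 2 - (i + j) = m + 1 - (i + j)\<close>, so the
  sum is its own negative.\<close>

lemma rect_sum_antisym:
  assumes antisym: "\<And>k. d (int m + 1 - k) = - d k" and PQ: "P + Q = m + 3"
  shows "rect_sum d P Q = 0"
proof -
  have "rect_sum d P Q = (\<Sum>i<P. \<Sum>j<Q. d (int (P - Suc i) + int (Q - Suc j)))"
    unfolding rect_sum_def
    by (subst sum.nat_diff_reindex[symmetric], subst (2) sum.nat_diff_reindex[symmetric]) simp
  also have "\<dots> = (\<Sum>i<P. \<Sum>j<Q. - d (int i + int j))"
  proof (intro sum.cong refl)
    fix i j assume "i \<in> {..<P}" "j \<in> {..<Q}"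
    then have "int (P - Suc i) + int (Q - Suc j) = int m + 1 - (int i + int j)"
      using PQ by auto
    then show "d (int (P - Suc i) + int (Q - Suc j)) = - d (int i + int j)"
      by (simp only: antisym)
  qed
  also have "\<dots> = - rect_sum d P Q"
    by (simp add: rect_sum_def sum_negf)
  finally show ?thesis by simp
qed

definition triangle :: "nat \<Rightarrow> point set" where
  "triangle m = {(x1, x2). int m \<ge> x1 \<and> x1 \<ge> x2 \<and> x2 \<ge> 0}"

lemma mem_triangle [simp]: "(x1, x2) \<in> triangle m \<longleftrightarrow> int m \<ge> x1 \<and> x1 \<ge> x2 \<and> x2 \<ge> 0"
  by (simp add: triangle_def)

lemma T_eq: "T n m = walks {(1, 0), (0, 1), (-1, -1)} (triangle m) n (0, 0)"
  by (auto simp: T_def walk_iff_successively walks_def num_steps_def triangle_def)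

text \<open>Points of the triangle and their neighbours outside it are treated together, so that the
  induction step may refer to all three neighbours. The outside ones contribute \<open>0\<close> to both sides.\<close>

lemma card_walks_triangle:
  assumes "P + Q \<le> m + 3"
  shows "int (card (walks {(1, 0), (0, 1), (-1, -1)} (triangle m) n (int P + int Q - 2, int Q - 1)))
    = rect_sum (mirrored_motzkin m n) P Q"
  using assms
proof (induction n arbitrary: P Q)
  case 0
  show ?case
  proof (cases "P = 0 \<or> Q = 0 \<or> P + Q = m + 3")
    case True
    then show ?thesis
      using rect_sum_antisym[of "mirrored_motzkin m 0", OF mirrored_motzkin_antisym] 
      by (auto simp: walks_0 rect_sum_def)
  next
    case False
    then obtain P' Q' where PQ: "P = Suc P'" "Q = Suc Q'" "P' + Q' \<le> m"
      using 0 by (cases P; cases Q) auto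
    \<comment> \<open>Since \<open>i + j \<le> m\<close> here, only the entry \<open>1\<close> at \<open>i = j = 0\<close> is met, not the \<open>-1\<close> at \<open>m + 1\<close>.\<close>
    have "rect_sum (mirrored_motzkin m 0) P Q = (\<Sum>i<P. \<Sum>j<Q. of_bool (i = 0) * of_bool (j = 0))"
      unfolding rect_sum_def using PQ by (intro sum.cong) auto
    also have "\<dots> = 1"
      using PQ by (simp add: sum.lessThan_Suc_shift del: sum.lessThan_Suc)
    finally show ?thesis using PQ by (simp add: walks_0 del: mirrored_motzkin.simps)
  qed
next
  case (Suc n)
  let ?W = "walks {(1, 0), (0, 1), (-1, -1)} (triangle m)"
  show ?case
  proof (cases "P = 0 \<or> Q = 0 \<or> P + Q = m + 3")
    case True
    then show ?thesis
      using rect_sum_antisym[of "mirrored_motzkin m (Suc n)", OF mirrored_motzkin_antisym] 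
      by (auto simp: walks_Suc rect_sum_def)
  next
    case False
    then obtain P' Q' where PQ: "P = Suc P'" "Q = Suc Q'" "P' + Q' \<le> m"
      using Suc.prems by (cases P; cases Q) auto
    have "int (card (?W (Suc n) (int P + int Q - 2, int Q - 1))) =
      int (card (?W n (int (Suc P) + int Q - 2, int Q - 1))) +
      int (card (?W n (int P' + int (Suc Q) - 2, int (Suc Q) - 1))) +
      int (card (?W n (int P + int Q' - 2, int Q' - 1)))"
      using PQ by (simp add: card_walks_Suc algebra_simps)
    also have "\<dots> = rect_sum (mirrored_motzkin m n) (Suc P) Q + rect_sum (mirrored_motzkin m n) P' (Suc Q) +
       rect_sum (mirrored_motzkin m n) P Q'"
      using PQ by (subst (1 2 3) Suc.IH) auto
    also have "\<dots> = rect_sum (\<lambda>k. mirrored_motzkin m n (k - 1) + mirrored_motzkin m n k + mirrored_motzkin m n (k + 1)) P Q"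
      using rect_sum_step[of "mirrored_motzkin m n" P' Q'] PQ by (simp add: mirrored_motzkin_left)
    also have "\<dots> = rect_sum (mirrored_motzkin m (Suc n)) P Q"
      unfolding rect_sum_def using PQ by (intro sum.cong) auto
    finally show ?thesis .
  qed
qed

lemma card_T:
  assumes m: "m = 2 * w \<or> m = 2 * w + 1"
  shows "int (card (T n m)) = motzkin_sum (\<lambda>h. 1 - of_bool (m = 2 * w \<and> h = int w)) w n (0, 0)"
proof -
  have "int (card (T n m)) = mirrored_motzkin m n 0"
    using card_walks_triangle[of 1 1 m n] by (simp add: T_eq rect_sum_def)
  also have "\<dots> = motzkin_sum (\<lambda>h. 1 - of_bool (m = 2 * w \<and> h = int w)) w n (0, 0)"
    using m by (intro motzkin_sum_reflection[symmetric]) (auto simp: mirrored_motzkin_left mirrored_motzkin_antisym)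
  finally show ?thesis .
qed

section \<open>Dyck prefixes in a strip\<close>

text \<open>Descending from the last point to the axis completes the path.\<close>

lemma extends_to_dyck_path:
  assumes "p \<in> walks {(1, 1), (1, -1)} {(x1, x2). 0 \<le> x2} n (0, 0)" "snd (last p) = int h"
  shows "\<exists>q. dyck_path (p @ q)"
  using assms
proof (induction h arbitrary: p n)
  case 0
  have "p \<in> walks {(1, 1), (1, -1), (1, 0)} {(x1, x2). 0 \<le> x2} n (0, 0)"
    using 0 by (auto simp: walks_def elim: successively_mono)
  then have "motzkin_path n p" using 0 by (intro motzkin_pathI) auto
  moreover have "horizontal_steps p = {}"
    using 0(1) by (force simp: horizontal_steps_def walks_def successively_conv_nth)
  ultimately have "dyck_path (p @ [])" by (auto simp: dyck_path_def)
  then show ?case ..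
next
  case (Suc h)
  obtain t where t: "last p = (t, int h + 1)"
    using Suc.prems by (cases "last p") auto
  let ?p = "p @ [(t + 1, int h)]"
  have "snd (last ?p) = int h" by simp
  moreover have "?p \<in> walks {(1, 1), (1, -1)} {(x1, x2). 0 \<le> x2} (Suc n) (0, 0)"
    using Suc.prems(1) t by (auto simp: walks_def successively_append_iff hd_append)
  ultimately obtain q where "dyck_path (?p @ q)" using Suc.IH by blast
  then show ?case by auto
qed

lemma DP_eq: "DP n m = walks {(1, 1), (1, -1)} (strip m) n (0, 0)"
proof (intro set_eqI iffI)
  fix p assume p: "p \<in> DP n m"
  then obtain q k where pq: "p \<noteq> []" "motzkin_path k (p @ q)" "horizontal_steps (p @ q) = {}"
    by (auto simp: DP_def dyck_prefix_def dyck_path_def)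
  have "p ! Suc i - p ! i \<in> {(1, 1), (1, -1)}" if "Suc i < length p" for i
  proof -
    have "(p @ q) ! Suc i - (p @ q) ! i \<in> {(1, 1), (1, -1), (1, 0)}"
      using pq that by (simp add: motzkin_path_def walk_def)
    moreover have "(p @ q) ! Suc i - (p @ q) ! i \<noteq> (1, 0)"
      using pq that by (auto simp: horizontal_steps_def)
    ultimately show ?thesis using that by (simp add: nth_append)
  qed
  moreover have "hd p = (0, 0)" using pq by (simp add: motzkin_path_def walk_def)
  ultimately show "p \<in> walks {(1, 1), (1, -1)} (strip m) n (0, 0)"
    using p pq(1) by (auto simp: walks_def DP_def num_steps_def strip_def successively_conv_nth)
next
  fix p assume p: "p \<in> walks {(1, 1), (1, -1)} (strip m) n (0, 0)"
  then have "p \<noteq> []" and "p \<in> walks {(1, 1), (1, -1)} {(x1, x2). 0 \<le> x2} n (0, 0)"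
    by (auto simp: walks_def strip_def)
  moreover from \<open>p \<noteq> []\<close> p have "last p \<in> strip m"
    by (auto simp: walks_def)
  ultimately show "p \<in> DP n m"
    using extends_to_dyck_path[of p n "nat (snd (last p))"] p
    by (auto simp: DP_def dyck_prefix_def num_steps_def walks_def strip_def)
qed

definition strip_count :: "nat \<Rightarrow> nat \<Rightarrow> int \<Rightarrow> int" where
  "strip_count m n h = int (card (walks {(1, 1), (1, -1)} (strip m) n (0, h)))"

lemma card_walks_strip:
  "int (card (walks {(1, 1), (1, -1)} (strip m) n (t, h))) = strip_count m n h"
  unfolding strip_count_def
proof (induction n arbitrary: t h)
  case (Suc n)
  show ?case using Suc[of "t + 1"] Suc[of 1] by (simp add: card_walks_Suc)
qed (simp add: walks_0)

lemma strip_count_0: "strip_count m 0 h = of_bool (0 \<le> h \<and> h \<le> int m)"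
  by (simp add: strip_count_def walks_0)

lemma strip_count_Suc:
  "strip_count m (Suc n) h =
    (if 0 \<le> h \<and> h \<le> int m then strip_count m n (h - 1) + strip_count m n (h + 1) else 0)"
  unfolding strip_count_def[of m "Suc n"] by (simp add: card_walks_Suc card_walks_strip[of m n])

lemma strip_count_outside: "h < 0 \<or> h > int m \<Longrightarrow> strip_count m n h = 0"
  by (cases n) (auto simp: strip_count_0 strip_count_Suc)

lemma strip_count_sym: "strip_count m n (int m - h) = strip_count m n h"
proof (induction n arbitrary: h)
  case (Suc n)
  show ?case using Suc[of "h - 1"] Suc[of "h + 1"] by (auto simp: strip_count_Suc algebra_simps)
qed (auto simp: strip_count_0)

lemma card_DP:
  assumes m: "m = 2 * w \<or> m = 2 * w + 1"
  shows "int (card (DP n m)) =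
    motzkin_sum (\<lambda>h. of_bool (h = 0) - of_bool (m = 2 * w \<and> h = int w)) w n (0, 0)"
proof -
  let ?e = "\<lambda>n k. strip_count m n k - strip_count m n (k - 1)"
  have "int (card (DP n m)) = ?e n 0"
    by (simp add: DP_eq card_walks_strip strip_count_outside)
  also have "\<dots> = motzkin_sum (\<lambda>h. of_bool (h = 0) - of_bool (m = 2 * w \<and> h = int w)) w n (0, 0)"
  proof (rule motzkin_sum_reflection[symmetric, OF m])
    show "?e 0 k = of_bool (k = 0)" if "0 \<le> k" "k \<le> int w" for k
      using that m by (auto simp: strip_count_0)
    show "?e (Suc n) k = ?e n (k - 1) + of_bool (k = 0) * ?e n k + ?e n (k + 1)"
      if "0 \<le> k" "k \<le> int w" for n k
      using that m by (auto simp: strip_count_Suc strip_count_outside)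
    show "?e n (- 1) = 0" for n by (simp add: strip_count_outside)
    show "?e n (int m + 1 - k) = - ?e n k" for n k
      using strip_count_sym[of m n k] strip_count_sym[of m n "k - 1"] by (simp add: algebra_simps)
  qed auto
  finally show ?thesis .
qed

section \<open>The four identities\<close>

lemma level_weight_indicator:
  "level_weight (\<lambda>h. of_bool (h \<in> A)) p = of_bool (\<forall>i\<in>horizontal_steps p. snd (p ! i) \<in> A)"
  by (auto simp: level_weight_def finite_horizontal_steps)

lemma level_weight_signed:
  "level_weight (\<lambda>h. of_bool (h \<in> A) * (if h = k then - 1 else 1)) p =
    of_bool (\<forall>i\<in>horizontal_steps p. snd (p ! i) \<in> A) * (- 1) ^ card (horizontal_steps_on k p)"
proof -
  have "(\<Prod>i\<in>horizontal_steps p. if snd (p ! i) = k then - 1 else 1) =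
      (- 1 :: int) ^ card (horizontal_steps_on k p)"
    by (simp add: horizontal_steps_on_def prod.inter_filter[symmetric] finite_horizontal_steps)
  then show ?thesis
    using level_weight_indicator[of A p] by (simp add: level_weight_def prod.distrib)
qed

theorem theorem9p3:
  fixes w n :: nat
  assumes "w > 0" and "n > 0"
  shows "card (T n (2 * w + 1)) = card (Mot n w) \<and>
         card (T n (2 * w)) = card (Mot' n w) \<and>
         card (DP n (2 * w + 1)) = card (Mot1 n w) \<and>
         int (card (DP n (2 * w))) =
           (\<Sum>p\<in>Mot2 n w. (-1) ^ card (horizontal_steps_on (int w) p))"
proof (intro conjI)
  have "int (card (T n (2 * w + 1))) = (\<Sum>p\<in>Mot n w. level_weight (\<lambda>h. of_bool (h \<in> UNIV)) p)"
    using card_T[of "2 * w + 1" w n] unfolding sum_level_weight_Mot by simp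
  then show "card (T n (2 * w + 1)) = card (Mot n w)"
    unfolding level_weight_indicator by simp
next
  have "(\<lambda>h. 1 - of_bool (h = int w)) = (\<lambda>h. of_bool (h \<in> - {int w}) :: int)" by auto
  then have "int (card (T n (2 * w))) =
      (\<Sum>p\<in>Mot n w. level_weight (\<lambda>h. of_bool (h \<in> - {int w})) p)"
    using card_T[of "2 * w" w n] unfolding sum_level_weight_Mot by simp
  also have "\<dots> = (\<Sum>p\<in>Mot' n w. 1)"
    unfolding level_weight_indicator
    by (rule sum.mono_neutral_cong_right) (auto simp: finite_Mot Mot'_def horizontal_steps_on_def)
  finally show "card (T n (2 * w)) = card (Mot' n w)" by simp
next
  have "int (card (DP n (2 * w + 1))) = (\<Sum>p\<in>Mot n w. level_weight (\<lambda>h. of_bool (h \<in> {0})) p)"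
    using card_DP[of "2 * w + 1" w n] assms unfolding sum_level_weight_Mot by simp
  also have "\<dots> = (\<Sum>p\<in>Mot1 n w. 1)"
    unfolding level_weight_indicator
    by (rule sum.mono_neutral_cong_right) (auto simp: finite_Mot Mot1_def horizontal_steps_on_def)
  finally show "card (DP n (2 * w + 1)) = card (Mot1 n w)" by simp
next
  have "(\<lambda>h. of_bool (h = 0) - of_bool (h = int w)) =
      (\<lambda>h. of_bool (h \<in> {0, int w}) * (if h = int w then - 1 else 1) :: int)"
    using assms by auto
  then have "int (card (DP n (2 * w))) = (\<Sum>p\<in>Mot n w.
      level_weight (\<lambda>h. of_bool (h \<in> {0, int w}) * (if h = int w then - 1 else 1)) p)"
    using card_DP[of "2 * w" w n] assms unfolding sum_level_weight_Mot by simp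
  also have "\<dots> = (\<Sum>p\<in>Mot2 n w. (-1) ^ card (horizontal_steps_on (int w) p))"
    unfolding level_weight_signed
    by (rule sum.mono_neutral_cong_right) (auto simp: finite_Mot Mot2_def horizontal_steps_on_def)
  finally show "int (card (DP n (2 * w))) =
      (\<Sum>p\<in>Mot2 n w. (-1) ^ card (horizontal_steps_on (int w) p))" .
qed

end
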